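(* Let $[\boldsymbol{X}]$ be a random $p$-hyper-rectangle with density function $f_{[\boldsymbol{X}]}\colon\mathbb{R}^{2p}\to\mathbb{R}$. Then its containment distribution function is given, for all real $\underline{x}_j\le\overline{x}_j$ ($j=1,\ldots,p$), by the $2p$-fold integral $$F_{[\boldsymbol{X}]}(\underline{x}_1,\overline{x}_1,\ldots,\underline{x}_p,\overline{x}_p)=\int_{\underline{x}_p}^{\overline{x}_p}\!\int_{\underline{x}_p}^{\overline{x}_p}\cdots\int_{\underline{x}_1}^{\overline{x}_1}\!\int_{\underline{x}_1}^{\overline{x}_1} f_{[\boldsymbol{X}]}(\underline{x}_1',\overline{x}_1',\ldots,\underline{x}_p',\overline{x}_p')\,\mathrm{d}\underline{x}_1'\,\mathrm{d}\overline{x}_1'\cdots\mathrm{d}\underline{x}_p'\,\mathrm{d}\overline{x}_p',$$ in which both $\underline{x}_j'$ and $\overline{x}_j'$ range over $[\underline{x}_j,\overline{x}_j]$ for each $j$.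
   Context: $\mathbb{I}=\{[x,y]\colon -\infty<x\le y<+\infty\}$ is the set of closed bounded intervals. A $p$-hyper-rectangle is a $p$-tuple $[\boldsymbol{x}]=([x_1],\ldots,[x_p])\in\mathbb{I}^p$ with $[x_j]=[\underline{x}_j,\overline{x}_j]$; $[\boldsymbol{x}']\subseteq[\boldsymbol{x}]$ means $[x_j']\subseteq[x_j]$ for every $j$. A random $p$-hyper-rectangle $[\boldsymbol{X}]=([X_1],\ldots,[X_p])$ is a $p$-tuple of random intervals, $[X_j]=[\underline{X}_j,\overline{X}_j]$, $\underline{X}_j\le\overline{X}_j$. Its density function $f_{[\boldsymbol{X}]}$ is the joint density of $(\underline{X}_1,\overline{X}_1,\ldots,\underline{X}_p,\overline{X}_p)$ with respect to Lebesgue measure on $\mathbb{R}^{2p}$ (zero where some lower endpoint exceeds the corresponding upper endpoint). Its containment distribution function $F_{[\boldsymbol{X}]}\colon\mathbb{R}^{2p}\to[0,1]$ is $F_{[\boldsymbol{X}]}(\underline{x}_1,\overline{x}_1,\ldots,\underline{x}_p,\overline{x}_p)=P([\boldsymbol{X}]\subseteq[\boldsymbol{x}])$ when $\underline{x}_j\le\overline{x}_j$ for all $j$, and $0$ otherwise. *)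

theory Defs
  imports "HOL-Probability.Probability" "HOL-Library.Interval"
begin

text \<open>
  A \<open>p\<close>-hyper-rectangle is a family \<open>R :: nat \<Rightarrow> real interval\<close>, of which only the components
  \<open>R j\<close> with \<open>j < p\<close> matter.  Points of the \<open>2p\<close>-dimensional real space are functions in
  \<^term>\<open>PiE {..<2 * p} (\<lambda>_. UNIV :: real set)\<close>: coordinate \<open>2 * j\<close> is the lower and coordinate
  \<open>2 * j + 1\<close> the upper endpoint of the \<open>j\<close>-th side (counting from \<open>0\<close>).
\<close>

definition hyper_rectangle_subset ::
    "nat \<Rightarrow> (nat \<Rightarrow> real interval) \<Rightarrow> (nat \<Rightarrow> real interval) \<Rightarrow> bool" where
  "hyper_rectangle_subset p R' R \<longleftrightarrow> (\<forall>j<p. set_of (R' j) \<subseteq> set_of (R j))"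

definition interleave :: "nat \<Rightarrow> (nat \<Rightarrow> real) \<Rightarrow> (nat \<Rightarrow> real) \<Rightarrow> nat \<Rightarrow> real" where
  "interleave p lo hi = (\<lambda>i\<in>{..<2 * p}. if even i then lo (i div 2) else hi (i div 2))"

definition random_hyper_rectangle ::
    "'w measure \<Rightarrow> nat \<Rightarrow> ('w \<Rightarrow> nat \<Rightarrow> real interval) \<Rightarrow> bool" where
  "random_hyper_rectangle M p X \<longleftrightarrow> prob_space M \<and>
     (\<forall>j<p. (\<lambda>\<omega>. lower (X \<omega> j)) \<in> borel_measurable M \<and>
            (\<lambda>\<omega>. upper (X \<omega> j)) \<in> borel_measurable M)"

definition hyper_rectangle_density ::
    "'w measure \<Rightarrow> nat \<Rightarrow> ('w \<Rightarrow> nat \<Rightarrow> real interval) \<Rightarrow> ((nat \<Rightarrow> real) \<Rightarrow> real) \<Rightarrow> bool" where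
  "hyper_rectangle_density M p X f \<longleftrightarrow>
     distributed M (\<Pi>\<^sub>M i\<in>{..<2 * p}. lborel)
       (\<lambda>\<omega>. interleave p (\<lambda>j. lower (X \<omega> j)) (\<lambda>j. upper (X \<omega> j))) (\<lambda>v. ennreal (f v)) \<and>
     (\<forall>v\<in>PiE {..<2 * p} (\<lambda>_. UNIV). 0 \<le> f v) \<and>
     (\<forall>v\<in>PiE {..<2 * p} (\<lambda>_. UNIV). (\<exists>j<p. v (2 * j + 1) < v (2 * j)) \<longrightarrow> f v = 0)"

definition containment_cdf ::
    "'w measure \<Rightarrow> nat \<Rightarrow> ('w \<Rightarrow> nat \<Rightarrow> real interval) \<Rightarrow> (nat \<Rightarrow> real) \<Rightarrow> real" where
  "containment_cdf M p X v =
     (if \<forall>j<p. v (2 * j) \<le> v (2 * j + 1)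
      then measure M {\<omega> \<in> space M.
             hyper_rectangle_subset p (X \<omega>) (\<lambda>j. Ivl (v (2 * j)) (v (2 * j + 1)))}
      else 0)"

text \<open>
  The iterated Lebesgue integral over the coordinates \<open>0, \<dots>, n - 1\<close>, coordinate \<open>i\<close> ranging
  over \<^term>\<open>{a i..b i}\<close>; coordinate \<open>0\<close> is integrated innermost and coordinate \<open>n - 1\<close>
  outermost.  The last argument holds the values of the coordinates that are not integrated.
\<close>

primrec iterated_integral ::
    "nat \<Rightarrow> (nat \<Rightarrow> real) \<Rightarrow> (nat \<Rightarrow> real) \<Rightarrow> ((nat \<Rightarrow> real) \<Rightarrow> real) \<Rightarrow> (nat \<Rightarrow> real) \<Rightarrow> real" where
  "iterated_integral 0 a b f v = f v"
| "iterated_integral (Suc n) a b f v =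
     (LBINT t:{a n..b n}. iterated_integral n a b f (v(n := t)))"

end

(* The containment event is the event that the vector of endpoints lies in the box in which both
   endpoints of side j range over [lo j, hi j], because lower \<le> upper holds for every interval.
   Its probability is therefore the integral of f over this box, and Fubini's theorem peels off
   one coordinate at a time, starting with coordinate 0. *)
theory Submission
  imports Defs
begin

context product_sigma_finite
begin

text \<open>Integrability companion of \<open>product_integral_insert\<close>: Fubini can be applied
  to the next coordinate only if the inner integral is again integrable. \<open>merge\<close>
  carries the binary product of \<open>Pi\<^sub>M I M\<close> and \<open>Pi\<^sub>M {i} M\<close> to
  the product over \<open>insert i I\<close>, so the claim reduces to Fubini for a pair of
  measures.\<close>

lemma product_integrable_insert:
  fixes f :: "_ \<Rightarrow> _::{banach, second_countable_topology}"
  assumes I: "finite I" "i \<notin> I"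
    and f: "integrable (Pi\<^sub>M (insert i I) M) f"
  shows "integrable (Pi\<^sub>M I M) (\<lambda>x. \<integral>y. f (x(i := y)) \<partial>M i)"
proof -
  interpret I: finite_product_sigma_finite M I by standard fact
  interpret J: finite_product_sigma_finite M "{i}" by standard simp
  interpret P: pair_sigma_finite "Pi\<^sub>M I M" "Pi\<^sub>M {i} M" ..
  have fi: "integrable (distr (Pi\<^sub>M I M \<Otimes>\<^sub>M Pi\<^sub>M {i} M) (Pi\<^sub>M (I \<union> {i}) M) (merge I {i})) f"
    using f I by (subst distr_merge) auto
  have "integrable (Pi\<^sub>M I M \<Otimes>\<^sub>M Pi\<^sub>M {i} M) (\<lambda>x. f (merge I {i} x))"
    by (rule integrable_distr[OF measurable_merge fi])
  then have "integrable (Pi\<^sub>M I M) (\<lambda>x. \<integral>y. f (merge I {i} (x, y)) \<partial>Pi\<^sub>M {i} M)"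
    by (rule P.integrable_fst')
  also have "?this \<longleftrightarrow> ?thesis"
  \<comment> \<open>Fubini yields an inner integral over the one-coordinate product
    \<open>Pi\<^sub>M {i} M\<close>. The integral over \<open>M i\<close> is rewritten in that form,
    so that only the two integrands remain to be compared.\<close>
  proof (rule Bochner_Integration.integrable_cong[OF refl], subst product_integral_singleton[symmetric])
    fix x assume x: "x \<in> space (Pi\<^sub>M I M)"
    have f_borel: "f \<in> borel_measurable (Pi\<^sub>M (insert i I) M)"
      using f by auto
    show "(\<lambda>y. f (x(i := y))) \<in> borel_measurable (M i)"
      using measurable_comp[OF measurable_component_update f_borel, OF x \<open>i \<notin> I\<close>]
      unfolding comp_def .
    from x I show "(\<integral>y. f (merge I {i} (x, y)) \<partial>Pi\<^sub>M {i} M)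
        = (\<integral>y. f (x(i := y i)) \<partial>Pi\<^sub>M {i} M)"
      by (auto intro!: Bochner_Integration.integral_cong arg_cong[where f=f]
          simp: merge_def space_PiM extensional_def PiE_def fun_eq_iff)
  qed
  finally show ?thesis .
qed

end

text \<open>The index set loses its least element, which matches \<open>iterated_integral\<close>,
  where smaller coordinates are integrated further inside.\<close>

lemma integral_PiM_Suc:
  fixes g :: "(nat \<Rightarrow> real) \<Rightarrow> real"
  assumes "n < N" and "integrable (Pi\<^sub>M {n..<N} (\<lambda>_. lborel)) g"
  shows "integrable (Pi\<^sub>M {Suc n..<N} (\<lambda>_. lborel)) (\<lambda>v. \<integral>t. g (v(n := t)) \<partial>lborel)"
    and "(\<integral>v. g v \<partial>Pi\<^sub>M {n..<N} (\<lambda>_. lborel))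
      = (\<integral>v. (\<integral>t. g (v(n := t)) \<partial>lborel) \<partial>Pi\<^sub>M {Suc n..<N} (\<lambda>_. lborel))"
proof -
  interpret product_sigma_finite "\<lambda>_::nat. lborel :: real measure" ..
  have "{n..<N} = insert n {Suc n..<N}"
    using assms(1) by auto
  with assms(2) have "integrable (Pi\<^sub>M (insert n {Suc n..<N}) (\<lambda>_. lborel)) g"
    by simp
  with \<open>{n..<N} = _\<close>
  show "integrable (Pi\<^sub>M {Suc n..<N} (\<lambda>_. lborel)) (\<lambda>v. \<integral>t. g (v(n := t)) \<partial>lborel)"
    and "(\<integral>v. g v \<partial>Pi\<^sub>M {n..<N} (\<lambda>_. lborel))
      = (\<integral>v. (\<integral>t. g (v(n := t)) \<partial>lborel) \<partial>Pi\<^sub>M {Suc n..<N} (\<lambda>_. lborel))"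
    by (simp_all add: product_integrable_insert product_integral_insert)
qed

text \<open>Membership in \<open>PiE\<close> includes being undefined off the index set.
  Extensionality of \<open>v\<close> supplies this for \<open>v(n := t)\<close>, so that only the
  constraints on the coordinates remain.\<close>

lemma indicator_box_fun_upd:
  assumes "n < N" and "v \<in> extensional {Suc n..<N}"
  shows "indicator (PiE {n..<N} B) (v(n := t))
    = (indicator (B n) t * indicator (PiE {Suc n..<N} B) v :: real)"
proof -
  have "{n..<N} = insert n {Suc n..<N}"
    using assms(1) by auto
  then have "v(n := t) \<in> PiE {n..<N} B \<longleftrightarrow> t \<in> B n \<and> v \<in> PiE {Suc n..<N} B"
    using assms(2) by (auto simp: PiE_iff extensional_def)
  then show ?thesis
    by (simp add: indicator_def)
qed

text \<open>The invariant of the peeling: coordinates below \<open>n\<close> are already integrated,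
  the others still carry the box indicator. Integrability is part of the induction because it is
  what permits the next use of Fubini.\<close>

lemma iterated_integral_partial:
  fixes f :: "(nat \<Rightarrow> real) \<Rightarrow> real" and a b :: "nat \<Rightarrow> real" and N :: nat
  defines "B \<equiv> \<lambda>n. PiE {n..<N} (\<lambda>i. {a i..b i})"
  assumes f: "integrable (Pi\<^sub>M {0..<N} (\<lambda>_. lborel)) (\<lambda>v. indicator (B 0) v * f v)"
  shows "n \<le> N \<Longrightarrow> integrable (Pi\<^sub>M {n..<N} (\<lambda>_. lborel))
           (\<lambda>v. indicator (B n) v * iterated_integral n a b f v) \<and>
         (\<integral>v. indicator (B n) v * iterated_integral n a b f v \<partial>Pi\<^sub>M {n..<N} (\<lambda>_. lborel))
           = (\<integral>v. indicator (B 0) v * f v \<partial>Pi\<^sub>M {0..<N} (\<lambda>_. lborel))"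
proof (induction n)
  case 0
  then show ?case using f by simp
next
  case (Suc n)
  let ?g = "\<lambda>v. indicator (B n) v * iterated_integral n a b f v"
  let ?h = "\<lambda>v. indicator (B (Suc n)) v * iterated_integral (Suc n) a b f v"
  from Suc have n: "n < N" and g: "integrable (Pi\<^sub>M {n..<N} (\<lambda>_. lborel)) ?g"
    and eq: "integral\<^sup>L (Pi\<^sub>M {n..<N} (\<lambda>_. lborel)) ?g
      = (\<integral>v. indicator (B 0) v * f v \<partial>Pi\<^sub>M {0..<N} (\<lambda>_. lborel))"
    by simp_all
  \<comment> \<open>The factor for the remaining box does not depend on \<open>t\<close> and leaves
    the integral; the factor for side \<open>n\<close> turns the integral over the line into the one
    over \<open>{a n..b n}\<close>. Points of the space are extensional, as the splitting of the
    indicator requires.\<close>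
  have cong: "(\<integral>t. ?g (v(n := t)) \<partial>lborel) = ?h v"
    if "v \<in> space (Pi\<^sub>M {Suc n..<N} (\<lambda>_. lborel))" for v
  proof -
    have "v \<in> extensional {Suc n..<N}"
      using that by (simp add: space_PiM PiE_iff)
    then have "(\<integral>t. ?g (v(n := t)) \<partial>lborel)
      = (\<integral>t. indicator (B (Suc n)) v *
            (indicator {a n..b n} t * iterated_integral n a b f (v(n := t))) \<partial>lborel)"
      unfolding B_def by (simp add: indicator_box_fun_upd[OF n] mult_ac)
    then show ?thesis
      by (simp add: set_lebesgue_integral_def)
  qed
  have "integrable (Pi\<^sub>M {Suc n..<N} (\<lambda>_. lborel)) ?h"
    by (rule iffD1[OF Bochner_Integration.integrable_cong[OF refl cong] integral_PiM_Suc(1)[OF n g]])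
  moreover have "integral\<^sup>L (Pi\<^sub>M {Suc n..<N} (\<lambda>_. lborel)) ?h
      = integral\<^sup>L (Pi\<^sub>M {n..<N} (\<lambda>_. lborel)) ?g"
    unfolding integral_PiM_Suc(2)[OF n g]
    by (rule Bochner_Integration.integral_cong[OF refl cong, symmetric])
  ultimately show ?case
    unfolding eq by (rule conjI)
qed

text \<open>This is the invariant at \<open>n = N\<close>. The product over the empty index set is a
  unit mass at \<open>\<lambda>_. undefined\<close>, which explains the last argument of
  \<open>iterated_integral\<close>.\<close>

lemma iterated_integral_eq_integral_PiM:
  fixes f :: "(nat \<Rightarrow> real) \<Rightarrow> real"
  assumes "integrable (Pi\<^sub>M {..<N} (\<lambda>_. lborel))
    (\<lambda>v. indicator (PiE {..<N} (\<lambda>i. {a i..b i})) v * f v)"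
  shows "iterated_integral N a b f (\<lambda>_. undefined)
    = (\<integral>v. indicator (PiE {..<N} (\<lambda>i. {a i..b i})) v * f v \<partial>Pi\<^sub>M {..<N} (\<lambda>_. lborel))"
  using iterated_integral_partial[of N a b f N] assms
  by (simp add: lessThan_atLeast0 PiM_empty lebesgue_integral_count_space_finite)

text \<open>Change of variables for the test function \<open>indicator A\<close>. Its composition
  with \<open>Y\<close> is the indicator of an event, integrable because \<open>M\<close> is finite,
  and integrability passes to the density side.\<close>

lemma distributed_real_measure:
  fixes f :: "'a \<Rightarrow> real"
  assumes "finite_measure M"
    and D: "distributed M N Y (\<lambda>x. ennreal (f x))"
    and nonneg: "\<forall>x\<in>space N. 0 \<le> f x"
    and A: "A \<in> sets N"
  shows "integrable N (\<lambda>x. indicator A x * f x)"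
    and "measure M (Y -` A \<inter> space M) = (\<integral>x. indicator A x * f x \<partial>N)"
proof -
  interpret finite_measure M by fact
  have Y: "Y \<in> measurable M N"
    using D by (rule distributed_measurable)
  have m: "Y -` A \<inter> space M \<in> sets M"
    using Y A by (rule measurable_sets)
  have ind: "indicator A \<in> borel_measurable N"
    using A by simp
  have "(\<lambda>w. indicator A (Y w) :: real) = indicator (Y -` A)"
    by (simp add: indicator_def fun_eq_iff)
  moreover have "integrable M (indicator (Y -` A) :: _ \<Rightarrow> real)"
    using m by (subst integrable_indicator_iff) (simp add: less_top[symmetric])
  ultimately show "integrable N (\<lambda>x. indicator A x * f x)"
    using distributed_integrable[OF D ind] nonneg by (simp add: mult.commute)
  show "measure M (Y -` A \<inter> space M) = (\<integral>x. indicator A x * f x \<partial>N)"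
    using distributed_integral[OF D ind] nonneg \<open>(\<lambda>w. indicator A (Y w)) = _\<close>
    by (simp add: mult.commute)
qed

lemma interleave_in_box_iff:
  "interleave p x y \<in> PiE {..<2 * p} (\<lambda>i. {lo (i div 2)..hi (i div 2)}) \<longleftrightarrow>
    (\<forall>j<p. x j \<in> {lo j..hi j} \<and> y j \<in> {lo j..hi j})"  (is "?L \<longleftrightarrow> ?R")
proof
  assume L: ?L
  show ?R
  proof (intro allI impI)
    fix j assume "j < p"
    then have "2 * j < 2 * p" "Suc (2 * j) < 2 * p" by auto
    with PiE_mem[OF L, of "2 * j"] PiE_mem[OF L, of "Suc (2 * j)"]
    show "x j \<in> {lo j..hi j} \<and> y j \<in> {lo j..hi j}"
      by (simp add: interleave_def)
  qed
next
  assume ?R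
  then show ?L
    by (auto simp: interleave_def PiE_iff)
qed

lemma hyper_rectangle_subset_iff_interleave:
  assumes "\<forall>j<p. lo j \<le> hi j"
  shows "hyper_rectangle_subset p R (\<lambda>j. Ivl (lo j) (hi j)) \<longleftrightarrow>
    interleave p (\<lambda>j. lower (R j)) (\<lambda>j. upper (R j))
      \<in> PiE {..<2 * p} (\<lambda>i. {lo (i div 2)..hi (i div 2)})"
proof -
  \<comment> \<open>Every interval has ordered endpoints, so \<open>Ivl a b\<close> can have
    endpoints \<open>a\<close> and \<open>b\<close> only if \<open>a \<le> b\<close>. This is where
    the hypothesis on \<open>lo\<close> and \<open>hi\<close> enters.\<close>
  have Ivl: "lower (Ivl a b) = a" "upper (Ivl a b) = b" if "a \<le> b" for a b :: real
    using that by (simp_all add: lower.rep_eq upper.rep_eq Ivl.rep_eq)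
  have "set_of (R j) \<subseteq> set_of (Ivl (lo j) (hi j)) \<longleftrightarrow>
      lower (R j) \<in> {lo j..hi j} \<and> upper (R j) \<in> {lo j..hi j}" if "j < p" for j
  proof -
    have "lo j \<le> hi j"
      using assms that by blast
    then show ?thesis
      \<comment> \<open>Inclusion directly gives \<open>lo j \<le> lower (R j)\<close> and
        \<open>upper (R j) \<le> hi j\<close>; the two crossed bounds follow by transitivity through
        \<open>lower (R j) \<le> upper (R j)\<close>.\<close>
      using order_trans[OF _ lower_le_upper, of "lo j" "R j"]
        order_trans[OF lower_le_upper, of "R j" "hi j"] by (auto simp: set_of_eq Ivl)
  qed
  then show ?thesis
    unfolding interleave_in_box_iff hyper_rectangle_subset_def by blast
qed

lemma containment_cdf_interleave:
  assumes "\<forall>j<p. lo j \<le> hi j"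
  shows "containment_cdf M p X (interleave p lo hi) =
    measure M ((\<lambda>\<omega>. interleave p (\<lambda>j. lower (X \<omega> j)) (\<lambda>j. upper (X \<omega> j)))
      -` PiE {..<2 * p} (\<lambda>i. {lo (i div 2)..hi (i div 2)}) \<inter> space M)"
proof -
  have ends: "interleave p lo hi (2 * j) = lo j" "interleave p lo hi (2 * j + 1) = hi j"
    if "j < p" for j
    using that by (auto simp: interleave_def)
  have "hyper_rectangle_subset p R
      (\<lambda>j. Ivl (interleave p lo hi (2 * j)) (interleave p lo hi (2 * j + 1)))
    \<longleftrightarrow> hyper_rectangle_subset p R (\<lambda>j. Ivl (lo j) (hi j))" for R
    unfolding hyper_rectangle_subset_def using ends by simp
  then show ?thesis
    unfolding containment_cdf_def hyper_rectangle_subset_iff_interleave[OF assms]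
    using assms ends by (auto simp: hyper_rectangle_subset_iff_interleave[OF assms]
        intro!: arg_cong[where f="measure M"])
qed

theorem theorem6:
  fixes M :: "'w measure" and p :: nat
    and X :: "'w \<Rightarrow> nat \<Rightarrow> real interval"
    and f :: "(nat \<Rightarrow> real) \<Rightarrow> real"
    and lo hi :: "nat \<Rightarrow> real"
  assumes "random_hyper_rectangle M p X"
    and "hyper_rectangle_density M p X f"
    and "\<forall>j<p. lo j \<le> hi j"
  shows "containment_cdf M p X (interleave p lo hi) =
    iterated_integral (2 * p) (\<lambda>i. lo (i div 2)) (\<lambda>i. hi (i div 2)) f (\<lambda>_. undefined)"
proof -
  \<comment> \<open>Coordinates \<open>2 * j\<close> and \<open>2 * j + 1\<close> have the same
    quotient by 2, so both endpoints of side \<open>j\<close> range over the same interval.\<close>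
  let ?B = "PiE {..<2 * p} (\<lambda>i. {lo (i div 2)..hi (i div 2)})"
  have fin: "finite_measure M"
    using assms(1) by (simp add: random_hyper_rectangle_def prob_space_def)
  have D: "distributed M (\<Pi>\<^sub>M i\<in>{..<2 * p}. lborel)
      (\<lambda>\<omega>. interleave p (\<lambda>j. lower (X \<omega> j)) (\<lambda>j. upper (X \<omega> j))) (\<lambda>v. ennreal (f v))"
    and nonneg: "\<forall>v\<in>space (\<Pi>\<^sub>M i\<in>{..<2 * p}. lborel). 0 \<le> f v"
    using assms(2) by (simp_all add: hyper_rectangle_density_def space_PiM)
  have "?B \<in> sets (\<Pi>\<^sub>M i\<in>{..<2 * p}. lborel)"
    by (rule sets_PiM_I_finite) simp_all
  note box = distributed_real_measure[OF fin D nonneg this]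
  show ?thesis
    unfolding containment_cdf_interleave[OF assms(3)] box(2)
    by (rule iterated_integral_eq_integral_PiM[OF box(1), symmetric])
qed

end
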